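(* Let $G$ be the generator of a continuous-time ergodic birth-and-death chain on $\{0, \dots, d\}$ with stationary probability mass function $\pi$, and let $\nu_0\ge \nu_1 \ge \dots \ge \nu_{d - 1} > \nu_d = 0$ be the eigenvalues of $-G$. For $k=0,\dots,d$ define $$Q_k := \nu_0^{-1} \cdots \nu_{k - 1}^{-1} (G + \nu_0 I) \cdots (G + \nu_{k-1} I),\qquad Q_0:=I.$$ Then the matrices $Q_k$, $0\le k\le d$, are all stochastic, and every row of $Q_d$ equals $\pi$.
   Context: A continuous-time birth-and-death chain on $\{0,\dots,d\}$ has a tridiagonal generator; ergodic means irreducible. Eigenvalues are listed with multiplicity. $I$ is the identity matrix. A square matrix is stochastic if its entries are nonnegative and each row sums to $1$. *)

theory Defs
  imports "Jordan_Normal_Form.Char_Poly"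
begin

definition generator :: "nat \<Rightarrow> real mat \<Rightarrow> bool" where
  "generator n G \<longleftrightarrow> G \<in> carrier_mat n n \<and>
     (\<forall>i<n. \<forall>j<n. i \<noteq> j \<longrightarrow> 0 \<le> G $$ (i, j)) \<and>
     (\<forall>i<n. (\<Sum>j<n. G $$ (i, j)) = 0)"

definition tridiagonal :: "nat \<Rightarrow> real mat \<Rightarrow> bool" where
  "tridiagonal n A \<longleftrightarrow>
     (\<forall>i<n. \<forall>j<n. (Suc i < j \<or> Suc j < i) \<longrightarrow> A $$ (i, j) = 0)"

(* Every state can be reached from every other through jumps of positive rate. *)
definition irreducible_chain :: "nat \<Rightarrow> real mat \<Rightarrow> bool" where
  "irreducible_chain n G \<longleftrightarrow>
     (\<forall>i<n. \<forall>j<n.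
        (i, j) \<in> {(a, b). a < n \<and> b < n \<and> a \<noteq> b \<and> 0 < G $$ (a, b)}\<^sup>*)"

(* The state space {0..d} has d + 1 elements. *)
definition ergodic_birth_death_generator :: "nat \<Rightarrow> real mat \<Rightarrow> bool" where
  "ergodic_birth_death_generator d G \<longleftrightarrow>
     generator (d + 1) G \<and> tridiagonal (d + 1) G \<and> irreducible_chain (d + 1) G"

definition prob_mass_vec :: "nat \<Rightarrow> real vec \<Rightarrow> bool" where
  "prob_mass_vec n p \<longleftrightarrow> p \<in> carrier_vec n \<and> (\<forall>i<n. 0 \<le> p $ i) \<and> (\<Sum>i<n. p $ i) = 1"

(* The transpose expresses the row-vector equation p G = 0. *)
definition stationary_pmf :: "nat \<Rightarrow> real mat \<Rightarrow> real vec \<Rightarrow> bool" where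
  "stationary_pmf n G p \<longleftrightarrow> prob_mass_vec n p \<and> transpose_mat G *\<^sub>v p = 0\<^sub>v n"

definition stochastic_mat :: "nat \<Rightarrow> real mat \<Rightarrow> bool" where
  "stochastic_mat n P \<longleftrightarrow> P \<in> carrier_mat n n \<and>
     (\<forall>i<n. \<forall>j<n. 0 \<le> P $$ (i, j)) \<and>
     (\<forall>i<n. (\<Sum>j<n. P $$ (i, j)) = 1)"

(* nu 0, ..., nu d are all the eigenvalues of A, listed with (algebraic) multiplicity,
   in nonincreasing order. *)
definition ordered_eigenvalues :: "nat \<Rightarrow> real mat \<Rightarrow> (nat \<Rightarrow> real) \<Rightarrow> bool" where
  "ordered_eigenvalues d A \<nu> \<longleftrightarrow>
     char_poly A = (\<Prod>i\<le>d. [:- \<nu> i, 1:]) \<and>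
     (\<forall>i j. i \<le> j \<longrightarrow> j \<le> d \<longrightarrow> \<nu> j \<le> \<nu> i)"

definition Q_mat :: "nat \<Rightarrow> real mat \<Rightarrow> (nat \<Rightarrow> real) \<Rightarrow> nat \<Rightarrow> real mat" where
  "Q_mat d G \<nu> k =
     (\<Prod>i<k. inverse (\<nu> i)) \<cdot>\<^sub>m
     foldr (\<lambda>i M. (G + \<nu> i \<cdot>\<^sub>m 1\<^sub>m (d + 1)) * M) [0..<k] (1\<^sub>m (d + 1))"

end

theory Submission
  imports Defs
begin

text \<open>
  For a birth-and-death generator \<open>G\<close> on \<open>n = d + 1\<close> states with characteristic polynomial \<open>\<chi>\<close>,
  the adjugate of \<open>x I - G\<close> has the entries \<open>w i j * p (min i j) * q (max i j)\<close>, where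
  \<open>p i\<close> and \<open>q j\<close> are the characteristic polynomials of the blocks strictly before \<open>i\<close> and
  strictly after \<open>j\<close>, and \<open>w i j\<close> is the product of the jump rates on the way from \<open>i\<close> to \<open>j\<close>.
  Hence the entries of \<open>(G + \<nu>\<^sub>0 I) \<cdots> (G + \<nu>\<^bsub>k-1\<^esub> I)\<close> are \<open>w i j\<close> times the divided difference of
  \<open>p (min i j) * q (max i j)\<close> at the \<open>n - k\<close> largest eigenvalues of \<open>G\<close>.  All the
  polynomials involved are real-rooted, and for every \<open>t\<close> the product \<open>p i * q j\<close> with \<open>i \<le> j\<close> has
  at most as many roots above \<open>t\<close> as \<open>\<chi>\<close> (Sturm and Cauchy interlacing).  With this
  domination the Leibniz rule exhibits the divided difference as a sum of nonnegative terms.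
  For \<open>k = d\<close> the rows are probability vectors in the left kernel of \<open>G\<close>, which contains only
  one such vector.
\<close>

section \<open>Divided differences\<close>

text \<open>The divided difference of \<open>g\<close> at the roots of the monic \<open>Q\<close> is the top coefficient of the
  interpolation polynomial, which is the remainder modulo \<open>Q\<close>; this form allows multiple roots.
  It is \<open>0\<close> for \<open>Q = 1\<close>.\<close>

definition divdiff :: "'a::field poly \<Rightarrow> 'a poly \<Rightarrow> 'a" where
  "divdiff Q g = coeff (g mod Q) (degree Q - 1)"

lemma divdiff_add: "divdiff Q (g + h) = divdiff Q g + divdiff Q h"
  by (simp add: divdiff_def poly_mod_add_left)

lemma divdiff_diff: "divdiff Q (g - h) = divdiff Q g - divdiff Q h"
  by (simp add: divdiff_def poly_mod_diff_left)

lemma divdiff_smult: "divdiff Q (Polynomial.smult c g) = c * divdiff Q g"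
  by (simp add: divdiff_def mod_smult_left)

lemma divdiff_0: "divdiff Q 0 = 0"
  by (simp add: divdiff_def)

lemma divdiff_sum: "divdiff Q (\<Sum>i\<in>A. f i) = (\<Sum>i\<in>A. divdiff Q (f i))"
  by (induction A rule: infinite_finite_induct) (auto simp: divdiff_0 divdiff_add)

lemma divdiff_dvd: "Q dvd g \<Longrightarrow> divdiff Q g = 0"
  by (simp add: divdiff_def mod_eq_0_iff_dvd)

lemma divdiff_less: "degree g < degree Q \<Longrightarrow> divdiff Q g = coeff g (degree Q - 1)"
  by (simp add: divdiff_def mod_poly_less)

lemma divdiff_cancel:
  assumes "Q \<noteq> 0"
  shows "divdiff ([:-x, 1:] * Q) ([:-x, 1:] * h) = divdiff Q h"
proof (cases "degree Q = 0")
  case True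
  then have "h mod Q = 0"
    using assms by (metis degree_mod_less not_less0)
  then show ?thesis
    by (simp add: divdiff_def mod_mult_mult1 del: mult_pCons_left)
next
  case False
  define r where "r = h mod Q"
  have "coeff r (degree Q) = 0"
    using assms False degree_mod_less[of Q h] by (auto simp: r_def coeff_eq_0)
  moreover have "degree ([:-x, 1:] * Q) = Suc (degree Q)"
    using assms by (simp add: degree_mult_eq del: mult_pCons_left)
  moreover have "([:-x, 1:] * h) mod ([:-x, 1:] * Q) = [:-x, 1:] * r"
    by (simp only: mod_mult_mult1 r_def)
  ultimately show ?thesis
    using False by (simp add: divdiff_def r_def coeff_pCons split: nat.splits)
qed

lemma divdiff_leibniz:
  assumes "Q \<noteq> 0"
  shows "divdiff ([:-x, 1:] * Q) ([:-m, 1:] * h) =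
    divdiff Q h + (x - m) * divdiff ([:-x, 1:] * Q) h"
proof -
  have "[:-m, 1:] * h = [:-x, 1:] * h + Polynomial.smult (x - m) h"
    by (simp add: algebra_simps smult_diff_left)
  then show ?thesis
    by (simp only: divdiff_add divdiff_smult divdiff_cancel[OF assms])
qed

definition linprod :: "'a::idom multiset \<Rightarrow> 'a poly" where
  "linprod M = (\<Prod>x\<in>#M. [:-x, 1:])"

lemma linprod_empty: "linprod {#} = 1"
  by (simp add: linprod_def)

lemma linprod_add_mset: "linprod (add_mset x M) = [:-x, 1:] * linprod M"
  by (simp add: linprod_def)

lemma linprod_union: "linprod (M + N) = linprod M * linprod N"
  by (simp add: linprod_def)

lemma linprod_nonzero: "linprod M \<noteq> 0"
  by (induction M) (auto simp: linprod_empty linprod_add_mset simp del: mult_pCons_left)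

lemma degree_linprod: "degree (linprod M) = size M"
  by (induction M) (auto simp: linprod_empty linprod_add_mset degree_mult_eq linprod_nonzero simp del: mult_pCons_left)

lemma lead_coeff_linprod: "lead_coeff (linprod M) = 1"
  by (induction M) (auto simp: linprod_empty linprod_add_mset lead_coeff_mult simp del: mult_pCons_left)

lemma proots_linprod: "proots (linprod M) = M"
  by (induction M) (auto simp: linprod_empty linprod_add_mset proots_mult linprod_nonzero simp del: mult_pCons_left)

lemma linprod_image: "linprod (image_mset x (mset_set A)) = (\<Prod>i\<in>A. [:- x i, 1:])"
  by (simp add: linprod_def prod_unfold_prod_mset image_mset.compositionality comp_def)

lemma prod_linear_nonzero: "(\<Prod>i\<in>A. [:- x i, 1:] :: 'a::idom poly) \<noteq> 0"
  by (metis linprod_image linprod_nonzero)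

lemma degree_prod_linear: "degree (\<Prod>i\<in>A. [:- x i, 1:] :: 'a::idom poly) = card A"
  by (metis linprod_image degree_linprod size_image_mset size_mset_set)

lemma lead_coeff_prod_linear: "lead_coeff (\<Prod>i\<in>A. [:- x i, 1:] :: 'a::idom poly) = 1"
  by (metis linprod_image lead_coeff_linprod)

lemma divdiff_linprod_nonneg:
  fixes x :: "nat \<Rightarrow> real"
  assumes "\<And>i j. i \<le> j \<Longrightarrow> j < n \<Longrightarrow> x i \<le> x j"
    and "k < n \<Longrightarrow>
      (\<forall>t\<ge>x k. size (filter_mset (\<lambda>m. t < m) M) \<le> card {i\<in>{k..<n}. t < x i})"
  shows "0 \<le> divdiff (\<Prod>i=k..<n. [:- x i, 1:]) (linprod M)"
  using assms(2)
proof (induction "size M" arbitrary: k M)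
  case 0
  then have M: "linprod M = 1" by (simp add: linprod_empty)
  show ?case
  proof (cases "k < n")
    case True
    then show ?thesis
      by (simp add: M divdiff_less degree_prod_linear coeff_1)
  qed (simp add: divdiff_def)
next
  case (Suc s)
  show ?case
  proof (cases "k < n")
    case False
    then show ?thesis by (simp add: divdiff_def)
  next
    case True
    let ?Q = "\<lambda>k. \<Prod>i=k..<n. [:- x i, 1:]"
    have Q: "?Q k = [:- x k, 1:] * ?Q (Suc k)"
      using True by (rule prod.atLeast_Suc_lessThan)
    show ?thesis
    proof (cases "\<exists>m\<in>#M. m \<le> x k")
      case True
      \<comment> \<open>A root \<open>m \<le> x k\<close> affects neither count, so the Leibniz rule splits it off.\<close>
      then obtain m M' where M: "M = add_mset m M'" and m: "m \<le> x k"
        by (metis mset_add)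
      have c: "size (filter_mset (\<lambda>m. t < m) M') \<le> card {i\<in>{k..<n}. t < x i}"
        if "t \<ge> x k" for t
        using Suc.prems \<open>k < n\<close> that m by (auto simp: M)
      have "0 \<le> divdiff (?Q k) (linprod M')"
        using c Suc.hyps(2) by (intro Suc.hyps(1)) (auto simp: M)
      moreover have "0 \<le> divdiff (?Q (Suc k)) (linprod M')"
      proof (rule Suc.hyps(1))
        show "\<forall>t\<ge>x (Suc k). size (filter_mset (\<lambda>m. t < m) M') \<le> card {i\<in>{Suc k..<n}. t < x i}"
          if "Suc k < n"
        proof (intro allI impI)
          fix t assume t: "x (Suc k) \<le> t"
          then have "x k \<le> t"
            using assms(1)[of k "Suc k"] that by simp
          moreover from this have "{i\<in>{k..<n}. t < x i} = {i\<in>{Suc k..<n}. t < x i}"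
            by (auto simp: Suc_le_eq order.strict_iff_order)
          ultimately show "size (filter_mset (\<lambda>m. t < m) M') \<le> card {i\<in>{Suc k..<n}. t < x i}"
            using c by metis
        qed
      qed (use Suc.hyps(2) M in auto)
      ultimately show ?thesis
        using m by (simp only: Q M linprod_add_mset divdiff_leibniz[OF prod_linear_nonzero]) simp
    next
      case False
      \<comment> \<open>All roots exceed \<open>x k\<close>, so the degree is so small that the value is \<open>0\<close> or \<open>1\<close>.\<close>
      then have "filter_mset (\<lambda>m. x k < m) M = M"
        by (auto simp: filter_mset_eq_conv not_le)
      then have "size M \<le> card {i\<in>{k..<n}. x k < x i}"
        using Suc.prems True by (metis order_refl)
      also have "\<dots> \<le> card {Suc k..<n}"
        by (intro card_mono) (auto simp: Suc_le_eq order.strict_iff_order)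
      finally have s: "size M \<le> n - Suc k" by simp
      then have "divdiff (?Q k) (linprod M) = coeff (linprod M) (n - Suc k)"
        using True by (simp add: divdiff_less degree_prod_linear degree_linprod)
      also have "\<dots> \<ge> 0"
        using s lead_coeff_linprod[of M]
        by (cases "size M = n - Suc k") (auto simp: degree_linprod coeff_eq_0)
      finally show ?thesis .
    qed
  qed
qed

lemma monic_eq_prod_linear:
  fixes f :: "'a::idom poly"
  assumes "degree f = card A" "lead_coeff f = 1" "inj_on x A" "finite A"
    and "\<And>i. i \<in> A \<Longrightarrow> poly f (x i) = 0"
  shows "f = (\<Prod>i\<in>A. [:- x i, 1:])"
proof (rule poly_eqI_degree_lead_coeff[where n = "card A" and A = "x ` A"])
  show "coeff f (card A) = coeff (\<Prod>i\<in>A. [:- x i, 1:]) (card A)"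
    using assms(1,2) lead_coeff_prod_linear[of x A] by (simp add: degree_prod_linear)
  show "poly f z = poly (\<Prod>i\<in>A. [:- x i, 1:]) z" if "z \<in> x ` A" for z
    using that assms(4,5) by (auto simp: poly_prod)
qed (use assms in \<open>auto simp: degree_prod_linear card_image\<close>)

lemma lagrange_coeff:
  fixes u :: "'a::field poly"
  assumes "degree u \<le> m" "inj_on y {..m}"
  shows "coeff u m = (\<Sum>l\<le>m. poly u (y l) / (\<Prod>i\<in>{..m} - {l}. y l - y i))"
proof -
  define c where "c = (\<lambda>l. poly u (y l) / (\<Prod>i\<in>{..m} - {l}. y l - y i))"
  define L where "L = (\<lambda>l. \<Prod>i\<in>{..m} - {l}. [:- y i, 1:])"
  have dL: "degree (L l) = m" if "l \<le> m" for l
    using that by (simp add: L_def degree_prod_linear)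
  have "u = (\<Sum>l\<le>m. Polynomial.smult (c l) (L l))"
  proof (rule poly_eqI_degree)
    fix z assume "z \<in> y ` {..m}"
    then obtain j where j: "j \<le> m" "z = y j" by auto
    have "poly (L l) z = 0" if "l \<le> m" "l \<noteq> j" for l
      using that j by (auto simp: L_def poly_prod)
    then have "poly (\<Sum>l\<le>m. Polynomial.smult (c l) (L l)) z = (\<Sum>l\<in>{j}. c l * poly (L l) z)"
      unfolding poly_sum poly_smult using j by (intro sum.mono_neutral_right) auto
    also have "\<dots> = poly u z"
    proof -
      have "(\<Prod>i\<in>{..m} - {j}. y j - y i) \<noteq> 0"
        using assms(2) j by (auto dest: inj_onD)
      then show ?thesis
        by (simp add: c_def L_def poly_prod j)
    qed
    finally show "poly u z = poly (\<Sum>l\<le>m. Polynomial.smult (c l) (L l)) z" by simp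
  next
    have *: "card (y ` {..m}) = Suc m"
      using assms(2) by (simp add: card_image)
    show "degree u < card (y ` {..m})"
      using assms(1) * by simp
    have "degree (\<Sum>l\<le>m. Polynomial.smult (c l) (L l)) \<le> m"
      by (intro degree_sum_le) (use dL in \<open>auto intro: order.trans[OF degree_smult_le]\<close>)
    then show "degree (\<Sum>l\<le>m. Polynomial.smult (c l) (L l)) < card (y ` {..m})"
      using * by simp
  qed
  then have "coeff u m = (\<Sum>l\<le>m. c l * coeff (L l) m)"
    by (metis (no_types, lifting) coeff_smult coeff_sum sum.cong)
  also have "\<dots> = (\<Sum>l\<le>m. c l)"
  proof (intro sum.cong refl)
    fix l assume "l \<in> {..m}"
    then have "coeff (L l) m = lead_coeff (L l)" using dL by simp
    also have "\<dots> = 1" unfolding L_def by (rule lead_coeff_prod_linear)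
    finally show "c l * coeff (L l) m = c l" by simp
  qed
  finally show ?thesis by (simp add: c_def)
qed

lemma sign_prod_diff:
  fixes x :: "nat \<Rightarrow> real"
  assumes "finite A" "card {i\<in>A. t < x i} = c" "\<And>i. i \<in> A \<Longrightarrow> t \<noteq> x i"
  shows "0 < (-1) ^ c * (\<Prod>i\<in>A. t - x i)"
  using assms
proof (induction A arbitrary: c)
  case (insert a A)
  have IH: "0 < (-1) ^ card {i\<in>A. t < x i} * (\<Prod>i\<in>A. t - x i)"
    using insert by auto
  show ?case
  proof (cases "t < x a")
    case True
    then have "{i \<in> insert a A. t < x i} = insert a {i\<in>A. t < x i}" by auto
    then have "c = Suc (card {i\<in>A. t < x i})"
      using insert by simp
    then have "(-1) ^ c * (\<Prod>i\<in>insert a A. t - x i) =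
        (x a - t) * ((-1) ^ card {i\<in>A. t < x i} * (\<Prod>i\<in>A. t - x i))"
      using insert by (simp add: algebra_simps)
    then show ?thesis using IH True by simp
  next
    case False
    then have "{i \<in> insert a A. t < x i} = {i\<in>A. t < x i}" by auto
    then have "(-1) ^ c * (\<Prod>i\<in>insert a A. t - x i) =
        (t - x a) * ((-1) ^ card {i\<in>A. t < x i} * (\<Prod>i\<in>A. t - x i))"
      using insert by (simp add: algebra_simps)
    moreover have "x a < t" using False insert by force
    ultimately show ?thesis using IH by simp
  qed
qed simp

lemma weakly_alternating_eq_0:
  fixes u :: "real poly"
  assumes "degree u < m" "strict_mono_on {..m} y"
    and "\<And>l. l \<le> m \<Longrightarrow> 0 \<le> (-1) ^ (m - l) * poly u (y l)"
  shows "u = 0"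
proof -
  have inj: "inj_on y {..m}"
    using assms(2) by (rule strict_mono_on_imp_inj_on)
  define D where "D = (\<lambda>l. \<Prod>i\<in>{..m} - {l}. y l - y i)"
  have D: "0 < (-1) ^ (m - l) * D l" if "l \<le> m" for l
    unfolding D_def
  proof (rule sign_prod_diff)
    have "{i \<in> {..m} - {l}. y l < y i} = {Suc l..m}"
      using strict_mono_on_less[OF assms(2)] that by auto
    then show "card {i \<in> {..m} - {l}. y l < y i} = m - l" by simp
    show "y l \<noteq> y i" if "i \<in> {..m} - {l}" for i
      using inj_onD[OF inj] that \<open>l \<le> m\<close> by auto
  qed simp
  have nn: "0 \<le> poly u (y l) / D l" if "l \<le> m" for l
  proof -
    have "poly u (y l) / D l = ((-1) ^ (m - l) * poly u (y l)) / ((-1) ^ (m - l) * D l)"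
      by simp
    then show ?thesis
      using assms(3)[OF that] D[OF that] by (simp only: zero_le_divide_iff) simp
  qed
  have "(\<Sum>l\<le>m. poly u (y l) / D l) = 0"
    using lagrange_coeff[of u m y] assms(1) inj by (simp add: coeff_eq_0 D_def)
  then have "poly u (y l) / D l = 0" if "l \<le> m" for l
    using that nn by (subst (asm) sum_nonneg_eq_0_iff) auto
  moreover have "D l \<noteq> 0" if "l \<le> m" for l
    using D[OF that] by auto
  ultimately have "poly u z = poly 0 z" if "z \<in> y ` {..m}" for z
    using that by auto
  moreover have "card (y ` {..m}) = Suc m"
    using inj by (simp add: card_image)
  ultimately show ?thesis
    using assms(1) by (intro poly_eqI_degree[where A = "y ` {..m}"]) auto
qed

lemma sign_linprod:
  fixes t :: real
  assumes "\<And>m. m \<in># M \<Longrightarrow> t < m"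
  shows "0 < (-1) ^ size M * poly (linprod M) t"
  using assms
proof (induction M)
  case (add m M)
  then have "0 < (m - t) * ((-1) ^ size M * poly (linprod M) t)" by simp
  then show ?case by (simp add: linprod_add_mset algebra_simps)
qed (simp add: linprod_empty)

text \<open>With too many roots above \<open>t\<close>, the factor collecting the other roots would still alternate
  weakly at all \<open>x l \<le> t\<close>, which are more points than its degree permits.\<close>

lemma roots_above_le:
  fixes x :: "nat \<Rightarrow> real"
  assumes "strict_mono_on {..<n} x" "size M < n"
    and alt: "\<And>l. l < n \<Longrightarrow> 0 \<le> (-1) ^ (n - Suc l) * poly (linprod M) (x l)"
  shows "size (filter_mset (\<lambda>m. t < m) M) \<le> card {l. l < n \<and> t < x l}"
proof (rule ccontr)
  define s where "s = card {l. l < n \<and> t < x l}"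
  define U where "U = filter_mset (\<lambda>m. \<not> t < m) M"
  define W where "W = filter_mset (\<lambda>m. t < m) M"
  assume "\<not> ?thesis"
  then have W: "s < size W" by (simp add: s_def W_def)
  have M: "M = W + U"
    unfolding W_def U_def by (rule multiset_partition)
  then have size: "size M = size W + size U" by simp
  have "{l. l < n \<and> t < x l} \<subseteq> {..<n}" by auto
  then have "s \<le> n"
    unfolding s_def using card_mono[OF finite_lessThan] by fastforce
  have low: "x l \<le> t" if "l < n - s" for l
  proof (rule ccontr)
    assume "\<not> x l \<le> t"
    have "{l..<n} \<subseteq> {l. l < n \<and> t < x l}"
    proof
      fix j assume j: "j \<in> {l..<n}"
      then have "x l \<le> x j"
        using assms(1) by (auto simp: strict_mono_on_def order.order_iff_strict)
      then show "j \<in> {l. l < n \<and> t < x l}"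
        using j \<open>\<not> x l \<le> t\<close> by auto
    qed
    then have "card {l..<n} \<le> s"
      unfolding s_def by (intro card_mono) auto
    then show False using that by simp
  qed
  define m where "m = n - Suc s"
  have m: "n = Suc (m + s)"
    using W size assms(2) by (simp add: m_def)
  have "Polynomial.smult ((-1) ^ (size W + s)) (linprod U) = 0"
  proof (rule weakly_alternating_eq_0[where y = x and m = m])
    show "strict_mono_on {..m} x"
      using assms(1) by (auto simp: strict_mono_on_def m)
    show "degree (Polynomial.smult ((-1) ^ (size W + s)) (linprod U)) < m"
      using W size assms(2) by (simp add: degree_linprod m)
    fix l assume l: "l \<le> m"
    have pos: "0 < (-1) ^ size W * poly (linprod W) (x l)"
      using low[of l] l m by (intro sign_linprod) (auto simp: W_def)
    have "0 \<le> (-1) ^ (n - Suc l) * poly (linprod M) (x l)"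
      using alt[of l] l m by simp
    also have "n - Suc l = (m - l) + s"
      using l m by simp
    also have "(-1) ^ ((m - l) + s) * poly (linprod M) (x l) =
      ((-1) ^ size W * poly (linprod W) (x l)) *
      ((-1) ^ (m - l) * poly (Polynomial.smult ((-1) ^ (size W + s)) (linprod U)) (x l))"
      by (simp add: M linprod_union power_add algebra_simps flip: power_mult_distrib)
    finally show "0 \<le> (-1) ^ (m - l) * poly (Polynomial.smult ((-1) ^ (size W + s)) (linprod U)) (x l)"
      using pos by (simp only: zero_le_mult_iff) linarith
  qed
  then show False by (simp add: linprod_nonzero)
qed

lemma alternating_roots:
  fixes f :: "real poly"
  assumes "degree f = m" "lead_coeff f = 1" "strict_mono_on {..m} y"
    and alt: "\<And>l. l \<le> m \<Longrightarrow> 0 < (-1) ^ (m - l) * poly f (y l)"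
  obtains x where "\<And>l. l < m \<Longrightarrow> y l < x l" "\<And>l. l < m \<Longrightarrow> x l < y (Suc l)"
    "strict_mono_on {..<m} x" "f = (\<Prod>l<m. [:- x l, 1:])"
proof -
  have "\<exists>z. y l < z \<and> z < y (Suc l) \<and> poly f z = 0" if l: "l < m" for l
  proof -
    have "y l < y (Suc l)"
      using assms(3) l by (auto simp: strict_mono_on_def)
    moreover have "poly f (y l) * poly f (y (Suc l)) < 0"
    proof -
      have "m - l = Suc (m - Suc l)" using l by simp
      then have "0 < - ((-1) ^ (m - Suc l) * poly f (y l))"
        using alt[of l] l by simp
      moreover have "0 < (-1) ^ (m - Suc l) * poly f (y (Suc l))"
        using alt[of "Suc l"] l by simp
      ultimately have "0 < - ((-1) ^ (m - Suc l) * poly f (y l)) * ((-1) ^ (m - Suc l) * poly f (y (Suc l)))"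
        by (rule mult_pos_pos)
      also have "\<dots> = - (poly f (y l) * poly f (y (Suc l))) * ((-1) ^ (m - Suc l) * (-1) ^ (m - Suc l))"
        by (simp only: mult_ac minus_mult_left mult_minus_right)
      finally show ?thesis
        by (simp flip: power_mult_distrib)
    qed
    ultimately show ?thesis
      using poly_IVT by metis
  qed
  then obtain x where x: "\<And>l. l < m \<Longrightarrow> y l < x l \<and> x l < y (Suc l) \<and> poly f (x l) = 0"
    by metis
  have mono: "strict_mono_on {..<m} x"
  proof (rule strict_mono_onI)
    fix i j assume ij: "i \<in> {..<m}" "j \<in> {..<m}" "i < j"
    then have "y (Suc i) \<le> y j"
      by (subst strict_mono_on_less_eq[OF assms(3)]) auto
    then show "x i < x j"
      using x[of i] x[of j] ij by auto
  qed
  have "f = (\<Prod>l<m. [:- x l, 1:])"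
    using assms(1,2) x strict_mono_on_imp_inj_on[OF mono]
    by (intro monic_eq_prod_linear) auto
  then show ?thesis
    using x mono that by metis
qed

section \<open>Characteristic polynomials of Jacobi matrices\<close>

text \<open>\<open>jac a b (Suc i)\<close> is the characteristic polynomial of the block on \<open>{0..<i}\<close> of the
  tridiagonal matrix with diagonal \<open>a\<close>, where \<open>b i\<close> is the product of the two entries coupling
  \<open>i - 1\<close> and \<open>i\<close>.  The shift makes the recursion uniform, and \<open>b 0\<close> has no effect.\<close>

fun jac :: "(nat \<Rightarrow> 'a::idom) \<Rightarrow> (nat \<Rightarrow> 'a) \<Rightarrow> nat \<Rightarrow> 'a poly" where
  "jac a b 0 = 0"
| "jac a b (Suc 0) = 1"
| "jac a b (Suc (Suc i)) = [:- a i, 1:] * jac a b (Suc i) - [:b i:] * jac a b i"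

lemma jac_degree_le_coeff:
  "degree (jac a b m) \<le> m - 1 \<and> (0 < m \<longrightarrow> coeff (jac a b m) (m - 1) = 1)"
proof (induction m rule: induct_nat_012)
  case (ge2 i)
  have "degree (jac a b (Suc (Suc i))) \<le> Suc i"
    unfolding jac.simps
  proof (rule degree_diff_le)
    show "degree ([:- a i, 1:] * jac a b (Suc i)) \<le> Suc i"
      using degree_mult_le[of "[:- a i, 1:]" "jac a b (Suc i)"] ge2 by simp
    show "degree ([:b i:] * jac a b i) \<le> Suc i"
      by (rule order.trans[OF degree_mult_le]) (use ge2 in auto)
  qed
  moreover have "coeff (jac a b (Suc i)) (Suc i) = 0" "coeff (jac a b i) (Suc i) = 0"
    using ge2 by (auto intro!: coeff_eq_0)
  ultimately show ?case
    using ge2 by simp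
qed auto

lemma degree_jac: "degree (jac a b (Suc m)) = m"
  using jac_degree_le_coeff[of a b "Suc m"] le_degree[of "jac a b (Suc m)" m] by simp

lemma lead_coeff_jac: "lead_coeff (jac a b (Suc m)) = 1"
  using jac_degree_le_coeff[of a b "Suc m"] by (simp add: degree_jac)

lemma monic_eventually_pos:
  fixes f :: "real poly"
  assumes "lead_coeff f = 1"
  shows "\<exists>R. \<forall>t\<ge>R. 0 < poly f t"
  using poly_pinfty_gt_lc[of f] assms by force

lemma monic_alternating_at_ends:
  fixes f :: "real poly"
  assumes "lead_coeff f = 1" "degree f = m" "finite S"
  shows "\<exists>L R. L < R \<and> (\<forall>z\<in>S. L < z \<and> z < R) \<and>
    0 < (-1) ^ m * poly f L \<and> 0 < poly f R"
proof -
  obtain R where R: "\<And>t. t \<ge> R \<Longrightarrow> 0 < poly f t"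
    using monic_eventually_pos[OF assms(1)] by auto
  let ?g = "Polynomial.smult ((-1) ^ m) (pcompose f [:0, -1:])"
  have "lead_coeff (pcompose f [:0, -1:]) = (-1) ^ m"
    using lead_coeff_comp[of "[:0, -1:]" f] assms(1,2) by simp
  then have "lead_coeff ?g = 1"
    by (simp only: lead_coeff_smult) (simp flip: power_mult_distrib)
  then obtain L where L: "\<And>t. t \<ge> L \<Longrightarrow> 0 < poly ?g t"
    using monic_eventually_pos by meson
  define B where "B = Max (insert (max R L) (abs ` S)) + 1"
  have B: "z < B" if "z \<in> insert (max R L) (abs ` S)" for z
  proof -
    have "z \<le> Max (insert (max R L) (abs ` S))"
      using assms(3) by (intro Max_ge that) blast
    then show ?thesis by (simp only: B_def)
  qed
  define C where "C = max B 1"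
  have C: "L \<le> C" "R \<le> C"
    using B[of "max R L"] by (auto simp: C_def)
  have "- C < z \<and> z < C" if "z \<in> S" for z
    using B[of "\<bar>z\<bar>"] that by (auto simp: C_def)
  moreover have "- C < C" by (simp add: C_def)
  moreover have "0 < (- 1) ^ m * poly f (- C)"
    using L[OF C(1)] by (simp add: poly_pcompose)
  ultimately show ?thesis
    using R[OF C(2)] by blast
qed

lemma jac_sturm:
  fixes a b :: "nat \<Rightarrow> real"
  assumes b: "\<And>i. 0 < b i"
  shows "\<exists>x. strict_mono_on {..<m} x \<and> jac a b (Suc m) = (\<Prod>l<m. [:- x l, 1:]) \<and>
    (\<forall>l<m. 0 < (-1) ^ (m - Suc l) * poly (jac a b m) (x l))"
proof (induction m)
  case 0
  then show ?case by (auto simp: strict_mono_on_def)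
next
  case (Suc m)
  then obtain x where x: "strict_mono_on {..<m} x" "jac a b (Suc m) = (\<Prod>l<m. [:- x l, 1:])"
    and alt: "\<And>l. l < m \<Longrightarrow> 0 < (-1) ^ (m - Suc l) * poly (jac a b m) (x l)"
    by auto
  let ?f = "jac a b (Suc (Suc m))"
  obtain L R where LR: "L < R" "\<forall>z\<in>x ` {..<m}. L < z \<and> z < R"
    "0 < (-1) ^ Suc m * poly ?f L" "0 < poly ?f R"
    using monic_alternating_at_ends[where f = ?f and m = "Suc m" and S = "x ` {..<m}",
          OF lead_coeff_jac degree_jac finite_imageI[OF finite_lessThan]] by blast
  define y where "y = (\<lambda>l. if l = 0 then L else if l = Suc m then R else x (l - 1))"
  have y: "strict_mono_on {..Suc m} y"
  proof (rule strict_mono_onI)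
    fix i j assume ij: "i \<in> {..Suc m}" "j \<in> {..Suc m}" "i < j"
    then obtain j' where j': "j = Suc j'" by (cases j) auto
    show "y i < y j"
    proof (cases i)
      case 0
      then show ?thesis using LR(1) LR(2) ij j' by (auto simp: y_def)
    next
      case (Suc i')
      then have "i' < m" using ij by simp
      moreover have "x i' < x j'" if "j' < m"
        using strict_mono_onD[OF x(1), of i' j'] that ij Suc j' by simp
      ultimately show ?thesis using LR(2) ij Suc j' by (auto simp: y_def)
    qed
  qed
  have root: "poly (jac a b (Suc m)) (x l) = 0" if "l < m" for l
    using that by (auto simp: x(2) poly_prod)
  have "0 < (-1) ^ (Suc m - l) * poly ?f (y l)" if le: "l \<le> Suc m" for l
  proof -
    consider "l = 0" | "l = Suc m" | l' where "l = Suc l'" "l' < m"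
      using le by (cases l; cases "l = Suc m") force+
    then show ?thesis
    proof cases
      case 3
      have "m - l' = Suc (m - Suc l')" using 3 by simp
      then have "(-1) ^ (Suc m - l) * poly ?f (y l) =
          b m * ((-1) ^ (m - Suc l') * poly (jac a b m) (x l'))"
        using 3 root[of l'] by (simp add: y_def)
      then show ?thesis using alt[of l'] 3 b[of m] by simp
    qed (use LR in \<open>simp_all add: y_def del: jac.simps\<close>)
  qed
  then obtain z where z: "\<And>l. l < Suc m \<Longrightarrow> y l < z l" "\<And>l. l < Suc m \<Longrightarrow> z l < y (Suc l)"
    "strict_mono_on {..<Suc m} z" "?f = (\<Prod>l<Suc m. [:- z l, 1:])"
    using alternating_roots[OF degree_jac lead_coeff_jac y] by blast
  have "0 < (-1) ^ (Suc m - Suc l) * poly (jac a b (Suc m)) (z l)" if l: "l < Suc m" for l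
  proof -
    have up: "z l < x i" if "l \<le> i" "i < m" for i
    proof -
      have "x l \<le> x i"
        by (subst strict_mono_on_less_eq[OF x(1)]) (use that in auto)
      then show ?thesis using z(2)[OF l] that by (simp add: y_def)
    qed
    have down: "x i < z l" if "i < l" for i
    proof -
      have "x i \<le> x (l - 1)"
        by (subst strict_mono_on_less_eq[OF x(1)]) (use that l in auto)
      then show ?thesis using z(1)[OF l] that l by (simp add: y_def)
    qed
    have "{i \<in> {..<m}. z l < x i} = {l..<m}"
      using up down by (force simp: not_le[symmetric])
    then have "0 < (-1) ^ (m - l) * (\<Prod>i<m. z l - x i)"
      using up down by (intro sign_prod_diff) (auto, metis less_irrefl not_le)
    then show ?thesis by (simp add: x(2) poly_prod)
  qed
  then show ?case using z(3,4) by blast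
qed

text \<open>\<open>rjac n a b j\<close> is the characteristic polynomial of the block on \<open>{j..<n}\<close>.\<close>

definition rjac :: "nat \<Rightarrow> (nat \<Rightarrow> 'a::idom) \<Rightarrow> (nat \<Rightarrow> 'a) \<Rightarrow> nat \<Rightarrow> 'a poly" where
  "rjac n a b j = jac (\<lambda>i. a (n - 1 - i)) (\<lambda>i. b (n - i)) (Suc n - j)"

lemma rjac_end [simp]: "rjac n a b n = 1" "rjac n a b (Suc n) = 0"
  by (simp_all add: rjac_def)

lemma rjac_step:
  assumes "j < n"
  shows "rjac n a b j = [:- a j, 1:] * rjac n a b (Suc j) - [:b (Suc j):] * rjac n a b (Suc (Suc j))"
proof -
  have "Suc n - j = Suc (Suc (n - 1 - j))" "Suc n - Suc j = Suc (n - 1 - j)"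
    "Suc n - Suc (Suc j) = n - 1 - j" "n - 1 - (n - 1 - j) = j" "n - (n - 1 - j) = Suc j"
    using assms by auto
  then show ?thesis
    unfolding rjac_def by (simp only: jac.simps)
qed

lemma jac_wronskian:
  assumes "j \<le> n"
  shows "jac a b (Suc j) * rjac n a b j - [:b j:] * (jac a b j * rjac n a b (Suc j)) = jac a b (Suc n)"
  using assms
proof (induction rule: inc_induct)
  case (step j)
  have *: "P * ((A * T1) - B1 * T2) - B0 * (P0 * T1) = (A * P - B0 * P0) * T1 - B1 * (P * T2)"
    for P P0 A B0 B1 T1 T2 :: "'a poly"
    by (simp add: algebra_simps)
  show ?case
    using step(3) unfolding rjac_step[OF step(2)] jac.simps * .
qed simp

lemma rjac_0: "rjac n a b 0 = jac a b (Suc n)"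
  using jac_wronskian[of 0 n a b] by simp

text \<open>At a root of the full characteristic polynomial both families solve the same recurrence
  with the same boundary condition.\<close>

lemma rjac_proportional:
  assumes "poly (jac a b (Suc n)) t = 0" "b 0 = 1" "j \<le> Suc n"
  shows "(\<Prod>i<j. b i) * poly (rjac n a b j) t = poly (rjac n a b 1) t * poly (jac a b j) t"
  using assms(3)
proof (induction j rule: induct_nat_012)
  case 0
  then show ?case using assms(1) by (simp add: rjac_0)
next
  case (ge2 j)
  let ?T = "\<lambda>j. poly (rjac n a b j) t" and ?P = "\<lambda>j. poly (jac a b j) t"
  let ?c = "\<lambda>j. \<Prod>i<j. b i"
  have T: "b (Suc j) * ?T (Suc (Suc j)) = (t - a j) * ?T (Suc j) - ?T j"
    using ge2(3) by (simp add: rjac_step[of j] algebra_simps)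
  have "?c (Suc (Suc j)) * ?T (Suc (Suc j)) = ?c (Suc j) * (b (Suc j) * ?T (Suc (Suc j)))"
    by simp
  also have "\<dots> = (t - a j) * (?c (Suc j) * ?T (Suc j)) - b j * (?c j * ?T j)"
    unfolding T by (simp add: algebra_simps)
  also have "\<dots> = (t - a j) * (?T 1 * ?P (Suc j)) - b j * (?T 1 * ?P j)"
    using ge2 by simp
  also have "\<dots> = ?T 1 * ?P (Suc (Suc j))"
    by (simp add: algebra_simps)
  finally show ?case .
qed (simp add: assms(2))

lemma size_filter_image_mset_set:
  "finite A \<Longrightarrow> size (filter_mset P (image_mset x (mset_set A))) = card {i\<in>A. P (x i)}"
  by (simp add: filter_mset_image_mset comp_def)

lemma proots_prod_linear:
  "proots (\<Prod>i\<in>A. [:- x i, 1:]) = image_mset x (mset_set A)"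
  unfolding linprod_image[symmetric] by (rule proots_linprod)

lemma linprod_proots_jac:
  fixes a b :: "nat \<Rightarrow> real"
  assumes "\<And>i. 0 < b i"
  shows "linprod (proots (jac a b (Suc m))) = jac a b (Suc m)"
proof -
  obtain x where "jac a b (Suc m) = (\<Prod>l<m. [:- x l, 1:])"
    using jac_sturm[of b, OF assms] by blast
  then show ?thesis by (metis linprod_image proots_linprod)
qed

definition roots_above :: "real poly \<Rightarrow> real \<Rightarrow> nat" where
  "roots_above p t = size (filter_mset (\<lambda>m. t < m) (proots p))"

lemma roots_above_mult:
  "p \<noteq> 0 \<Longrightarrow> q \<noteq> 0 \<Longrightarrow> roots_above (p * q) t = roots_above p t + roots_above q t"
  by (simp add: roots_above_def proots_mult)

lemma roots_above_prod_linear: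
  "finite A \<Longrightarrow> roots_above (\<Prod>i\<in>A. [:- x i, 1:]) t = card {i\<in>A. t < x i}"
  by (simp add: roots_above_def proots_prod_linear size_filter_image_mset_set)

lemma roots_above_weakly_alternating:
  assumes "linprod (proots g) = g" "degree g < n" "strict_mono_on {..<n} x"
    and "\<And>l. l < n \<Longrightarrow> 0 \<le> (-1) ^ (n - Suc l) * poly g (x l)"
  shows "roots_above g t \<le> roots_above (\<Prod>l<n. [:- x l, 1:]) t"
proof -
  have "size (proots g) < n"
    using assms(1,2) degree_linprod by metis
  then have "roots_above g t \<le> card {l. l < n \<and> t < x l}"
    unfolding roots_above_def using assms by (intro roots_above_le) auto
  then show ?thesis by (simp add: roots_above_prod_linear)
qed

lemma roots_above_jac_Suc:
  fixes a b :: "nat \<Rightarrow> real"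
  assumes "\<And>i. 0 < b i"
  shows "roots_above (jac a b (Suc m)) t \<le> roots_above (jac a b (Suc (Suc m))) t"
proof -
  obtain x where x: "strict_mono_on {..<Suc m} x" "jac a b (Suc (Suc m)) = (\<Prod>l<Suc m. [:- x l, 1:])"
    "\<And>l. l < Suc m \<Longrightarrow> 0 < (-1) ^ (Suc m - Suc l) * poly (jac a b (Suc m)) (x l)"
    using jac_sturm[of b, OF assms] by blast
  show ?thesis
    unfolding x(2) using x(1,3)
    by (intro roots_above_weakly_alternating) (auto simp: linprod_proots_jac assms degree_jac less_imp_le)
qed

lemma jac_nonzero: "jac a b (Suc m) \<noteq> 0"
  using lead_coeff_jac[of a b m] by auto

lemma roots_above_jac_rjac:
  fixes a b :: "nat \<Rightarrow> real"
  assumes b: "\<And>i. 0 < b i" "b 0 = 1" and ij: "i \<le> j" "j < n"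
  shows "roots_above (jac a b (Suc i) * rjac n a b (Suc j)) t \<le> roots_above (jac a b (Suc n)) t"
proof -
  let ?P = "jac a b" and ?T = "rjac n a b"
  let ?J = "jac (\<lambda>i. a (n - 1 - i)) (\<lambda>i. b (n - i))"
  have T: "?T (Suc l) = ?J (Suc (n - Suc l))" if "l < n" for l
    using that by (simp add: rjac_def Suc_diff_Suc)
  have nz: "?T (Suc l) \<noteq> 0" if "l < n" for l
    using T[OF that] jac_nonzero by metis
  have "roots_above (?T (Suc j)) t \<le> roots_above (?T (Suc i)) t"
  proof -
    have "roots_above (?J (Suc (n - Suc j))) t \<le> roots_above (?J (Suc (n - Suc i))) t"
      by (rule lift_Suc_mono_le[of "\<lambda>l. roots_above (?J (Suc l)) t"])
        (use ij in \<open>auto simp del: jac.simps intro!: roots_above_jac_Suc b\<close>)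
    then show ?thesis using ij by (simp add: T)
  qed
  then have "roots_above (?P (Suc i) * ?T (Suc j)) t \<le> roots_above (?P (Suc i) * ?T (Suc i)) t"
    using nz ij by (simp add: roots_above_mult jac_nonzero)
  also obtain x where x: "strict_mono_on {..<n} x" "?J (Suc n) = (\<Prod>l<n. [:- x l, 1:])"
    "\<And>l. l < n \<Longrightarrow> 0 < (-1) ^ (n - Suc l) * poly (?J n) (x l)"
    using jac_sturm[of "\<lambda>i. b (n - i)" n "\<lambda>i. a (n - 1 - i)", OF b(1)] by blast
  have chi: "?P (Suc n) = (\<Prod>l<n. [:- x l, 1:])"
    using x(2) rjac_0[of n a b] by (simp only: rjac_def minus_nat.diff_0)
  have "roots_above (?P (Suc i) * ?T (Suc i)) t \<le> roots_above (?P (Suc n)) t"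
    unfolding chi
  proof (rule roots_above_weakly_alternating)
    show "linprod (proots (?P (Suc i) * ?T (Suc i))) = ?P (Suc i) * ?T (Suc i)"
      using ij by (simp add: proots_mult linprod_union linprod_proots_jac jac_nonzero T b)
    show "degree (?P (Suc i) * ?T (Suc i)) < n"
      using ij by (simp add: degree_mult_eq degree_jac jac_nonzero T)
    show "strict_mono_on {..<n} x" by (rule x)
    fix l assume l: "l < n"
    let ?c = "\<Prod>i<Suc i. b i"
    have "0 < ?c" by (intro prod_pos) (simp add: b)
    have "poly (?P (Suc n)) (x l) = 0"
      using l by (auto simp: chi poly_prod)
    then have "?c * poly (?T (Suc i)) (x l) = poly (?T 1) (x l) * poly (?P (Suc i)) (x l)"
      using ij by (intro rjac_proportional) (auto simp: b)
    moreover have "c * (e * (p * q)) = (e * r) * p\<^sup>2" if "c * q = r * p" for c e p q r :: real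
      using that by (simp add: power2_eq_square) algebra
    ultimately have "?c * ((-1) ^ (n - Suc l) * poly (?P (Suc i) * ?T (Suc i)) (x l)) =
        ((-1) ^ (n - Suc l) * poly (?T 1) (x l)) * (poly (?P (Suc i)) (x l))\<^sup>2"
      by (simp only: poly_mult)
    moreover have "0 < (-1) ^ (n - Suc l) * poly (?T 1) (x l)"
      using x(3)[OF l] by (simp add: rjac_def)
    ultimately have "0 \<le> ?c * ((-1) ^ (n - Suc l) * poly (?P (Suc i) * ?T (Suc i)) (x l))"
      by (metis less_imp_le mult_nonneg_nonneg zero_le_power2)
    then show "0 \<le> (-1) ^ (n - Suc l) * poly (?P (Suc i) * ?T (Suc i)) (x l)"
      using \<open>0 < ?c\<close> by (simp only: zero_le_mult_iff) linarith
  qed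
  finally show ?thesis .
qed

lemma divdiff_jac_nonneg:
  fixes a b x :: "nat \<Rightarrow> real"
  assumes b: "\<And>i. 0 < b i" "b 0 = 1" and ij: "i \<le> j" "j < n"
    and chi: "jac a b (Suc n) = (\<Prod>i<n. [:- x i, 1:])"
    and mono: "\<And>i j. i \<le> j \<Longrightarrow> j < n \<Longrightarrow> x i \<le> x j"
  shows "0 \<le> divdiff (\<Prod>i=k..<n. [:- x i, 1:]) (jac a b (Suc i) * rjac n a b (Suc j))"
proof -
  let ?g = "jac a b (Suc i) * rjac n a b (Suc j)"
  have T: "rjac n a b (Suc j) = jac (\<lambda>i. a (n - 1 - i)) (\<lambda>i. b (n - i)) (Suc (n - Suc j))"
    using ij by (simp add: rjac_def Suc_diff_Suc)
  have "linprod (proots ?g) = ?g"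
    by (simp add: T proots_mult linprod_union linprod_proots_jac jac_nonzero b)
  moreover have "0 \<le> divdiff (\<Prod>i=k..<n. [:- x i, 1:]) (linprod (proots ?g))"
  proof (rule divdiff_linprod_nonneg[OF mono])
    assume "k < n"
    show "\<forall>t\<ge>x k. size (filter_mset (\<lambda>m. t < m) (proots ?g)) \<le> card {i\<in>{k..<n}. t < x i}"
    proof (intro allI impI)
      fix t assume t: "x k \<le> t"
      have "size (filter_mset (\<lambda>m. t < m) (proots ?g)) \<le> card {i\<in>{..<n}. t < x i}"
        using roots_above_jac_rjac[of b i j n a t, OF b ij]
        unfolding chi roots_above_prod_linear[OF finite_lessThan] by (simp add: roots_above_def)
      also have "{i\<in>{..<n}. t < x i} = {i\<in>{k..<n}. t < x i}"
      proof -
        have "k \<le> i" if "t < x i" for i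
          using t mono[of i k] \<open>k < n\<close> that by (cases "k \<le> i") auto
        then show ?thesis by auto
      qed
      finally show "size (filter_mset (\<lambda>m. t < m) (proots ?g)) \<le> card {i\<in>{k..<n}. t < x i}" .
    qed
  qed auto
  ultimately show ?thesis by simp
qed

section \<open>Birth-and-death generators\<close>

lemma sum_tridiagonal:
  fixes f :: "nat \<Rightarrow> 'a::comm_monoid_add"
  assumes "j < n" "\<And>l. l < n \<Longrightarrow> Suc l < j \<or> Suc j < l \<Longrightarrow> f l = 0"
  shows "(\<Sum>l<n. f l) =
    (if j = 0 then 0 else f (j - 1)) + f j + (if Suc j < n then f (Suc j) else 0)"
proof -
  define S where "S = (if j = 0 then {} else {j - 1}) \<union> {j} \<union> (if Suc j < n then {Suc j} else {})"
  have "l \<in> S" if "l < n" "f l \<noteq> 0" for l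
  proof -
    have "\<not> (Suc l < j \<or> Suc j < l)"
      using assms(2) that by blast
    then show ?thesis using that by (auto simp: S_def)
  qed
  moreover have "S \<subseteq> {..<n}"
    using assms(1) by (auto simp: S_def)
  ultimately have "(\<Sum>l<n. f l) = sum f S"
    by (intro sum.mono_neutral_right) blast+
  also have "\<dots> = (if j = 0 then 0 else f (j - 1)) + f j + (if Suc j < n then f (Suc j) else 0)"
    by (simp add: S_def ac_simps)
  finally show ?thesis .
qed

lemma rtrancl_closed:
  assumes "(x, y) \<in> R\<^sup>*" "x \<in> S" "\<And>u v. (u, v) \<in> R \<Longrightarrow> u \<in> S \<Longrightarrow> v \<in> S"
  shows "y \<in> S"
  using assms by (induction rule: rtrancl_induct) auto

lemma irreducible_tridiagonal_pos:
  assumes "generator n G" "tridiagonal n G" "irreducible_chain n G" "Suc i < n"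
  shows "0 < G $$ (i, Suc i)" "0 < G $$ (Suc i, i)"
proof -
  let ?R = "{(a, b). a < n \<and> b < n \<and> a \<noteq> b \<and> 0 < G $$ (a, b)}"
  have step: "Suc u = v \<or> Suc v = u" if "(u, v) \<in> ?R" for u v
  proof (rule ccontr)
    assume "\<not> ?thesis"
    then have "Suc u < v \<or> Suc v < u" using that by auto
    then show False using assms(2) that by (auto simp: tridiagonal_def)
  qed
  have reach: "(i, Suc i) \<in> ?R\<^sup>*" "(Suc i, i) \<in> ?R\<^sup>*"
    using assms(3,4) by (auto simp: irreducible_chain_def)
  show "0 < G $$ (i, Suc i)"
  proof (rule ccontr)
    assume neg: "\<not> ?thesis"
    have "Suc i \<in> {..i}"
    proof (rule rtrancl_closed[OF reach(1)])
      fix u v assume uv: "(u, v) \<in> ?R" "u \<in> {..i}"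
      then have "\<not> (u = i \<and> v = Suc i)" using neg by auto
      then show "v \<in> {..i}" using step[OF uv(1)] uv(2) by auto
    qed simp
    then show False by simp
  qed
  show "0 < G $$ (Suc i, i)"
  proof (rule ccontr)
    assume neg: "\<not> ?thesis"
    have "i \<in> {Suc i..}"
    proof (rule rtrancl_closed[OF reach(2)])
      fix u v assume uv: "(u, v) \<in> ?R" "u \<in> {Suc i..}"
      then have "\<not> (u = Suc i \<and> v = i)" using neg by auto
      then show "v \<in> {Suc i..}" using step[OF uv(1)] uv(2) by auto
    qed simp
    then show False by simp
  qed
qed

locale birth_death =
  fixes n :: nat and G :: "real mat"
  assumes G_carrier: "G \<in> carrier_mat n n"
    and tri: "\<And>i j. i < n \<Longrightarrow> j < n \<Longrightarrow> Suc i < j \<or> Suc j < i \<Longrightarrow> G $$ (i, j) = 0"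
    and up_pos: "\<And>i. Suc i < n \<Longrightarrow> 0 < G $$ (i, Suc i)"
    and down_pos: "\<And>i. Suc i < n \<Longrightarrow> 0 < G $$ (Suc i, i)"
begin

definition a :: "nat \<Rightarrow> real" where
  "a i = G $$ (i, i)"

text \<open>The value \<open>1\<close> off the chain keeps \<open>b\<close> positive everywhere and normalises \<open>b 0\<close>.\<close>

definition b :: "nat \<Rightarrow> real" where
  "b i = (if 0 < i \<and> i < n then G $$ (i - 1, i) * G $$ (i, i - 1) else 1)"

abbreviation "P \<equiv> jac a b"
abbreviation "T \<equiv> rjac n a b"

lemma b_pos: "0 < b i"
  using up_pos[of "i - 1"] down_pos[of "i - 1"] by (auto simp: b_def)

lemma b_0: "b 0 = 1"
  by (simp add: b_def)

definition w :: "nat \<Rightarrow> nat \<Rightarrow> real" where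
  "w i j = (\<Prod>l=i..<j. G $$ (l, Suc l)) * (\<Prod>l=j..<i. G $$ (Suc l, l))"

lemma w_refl: "w i i = 1"
  by (simp add: w_def)

lemma w_up: "i \<le> j \<Longrightarrow> w i (Suc j) = w i j * G $$ (j, Suc j)"
  by (simp add: w_def)

lemma w_down: "j < i \<Longrightarrow> w i j = G $$ (Suc j, j) * w i (Suc j)"
  by (simp add: w_def prod.atLeast_Suc_lessThan)

lemma w_pos: "i < n \<Longrightarrow> j < n \<Longrightarrow> 0 < w i j"
  unfolding w_def by (intro mult_pos_pos prod_pos) (auto intro: up_pos down_pos)

text \<open>The adjugate of \<open>x I - G\<close>.\<close>

definition r :: "nat \<Rightarrow> nat \<Rightarrow> real poly" where
  "r i j = [:w i j:] * (P (Suc (min i j)) * T (Suc (max i j)))"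

lemma r_le: "i \<le> j \<Longrightarrow> r i j = [:w i j:] * (P (Suc i) * T (Suc j))"
  by (simp add: r_def min_absorb1 max_absorb2)

lemma r_ge: "j \<le> i \<Longrightarrow> r i j = [:w i j:] * (P (Suc j) * T (Suc i))"
  by (simp add: r_def min_absorb2 max_absorb1)

lemma r_next:
  assumes "i \<le> j" "j < n"
  shows "(if Suc j < n then [:G $$ (Suc j, j):] * r i (Suc j) else 0) =
    [:w i j:] * ([:b (Suc j):] * (P (Suc i) * T (Suc (Suc j))))"
proof (cases "Suc j < n")
  case True
  have "G $$ (Suc j, j) * w i (Suc j) = w i j * b (Suc j)"
    using True assms by (simp add: w_up b_def)
  then have *: "[:G $$ (Suc j, j):] * [:w i (Suc j):] = [:w i j:] * [:b (Suc j):]"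
    by (simp add: mult.commute)
  show ?thesis
    unfolding r_le[OF le_SucI[OF assms(1)]] if_P[OF True]
    by (simp only: * mult.assoc[symmetric])
next
  case False
  then have "Suc j = n" using assms by simp
  then show ?thesis by auto
qed

lemma r_prev:
  assumes "j \<le> i" "i < n"
  shows "(if j = 0 then 0 else [:G $$ (j - 1, j):] * r i (j - 1)) =
    [:w i j:] * ([:b j:] * (P j * T (Suc i)))"
proof (cases j)
  case (Suc j')
  have "G $$ (j', j) * w i j' = w i j * b j"
    using Suc assms w_down[of j' i] by (simp add: b_def)
  then have *: "[:G $$ (j', j):] * [:w i j':] = [:w i j:] * [:b j:]"
    by (simp add: mult.commute)
  have "r i j' = [:w i j':] * (P j * T (Suc i))"
    using Suc assms(1) by (simp only: r_ge Suc_leD)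
  then have "[:G $$ (j', j):] * r i j' = [:w i j:] * ([:b j:] * (P j * T (Suc i)))"
    by (simp only: * mult.assoc[symmetric])
  then show ?thesis by (simp only: Suc) simp
qed simp

lemma linear_split: "[:- c, 1:] = [:0, 1:] - [:c:]" for c :: real
  by simp

lemma adjugate_equation:
  assumes ij: "i < n" "j < n"
  shows "(\<Sum>l<n. [:G $$ (l, j):] * r i l) =
    [:0, 1:] * r i j - (if i = j then P (Suc n) else 0)"
proof -
  have "(\<Sum>l<n. [:G $$ (l, j):] * r i l) =
    (if j = 0 then 0 else [:G $$ (j - 1, j):] * r i (j - 1)) + [:a j:] * r i j +
    (if Suc j < n then [:G $$ (Suc j, j):] * r i (Suc j) else 0)"
    using ij by (subst sum_tridiagonal[of j]) (auto simp: tri a_def)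
  also have "\<dots> = [:0, 1:] * r i j - (if i = j then P (Suc n) else 0)"
  proof (cases i j rule: linorder_cases)
    case less
    then obtain j' where j': "j = Suc j'" by (cases j) auto
    have "[:G $$ (j', j):] * [:w i j':] = [:w i j:]"
      using less by (simp add: j' w_up)
    moreover have "r i j' = [:w i j':] * (P (Suc i) * T j)"
      using less by (simp only: j' r_le less_Suc_eq_le)
    ultimately have "[:G $$ (j', j):] * r i j' = [:w i j:] * (P (Suc i) * T j)"
      by (simp only: mult.assoc[symmetric])
    then have 1: "(if j = 0 then 0 else [:G $$ (j - 1, j):] * r i (j - 1)) =
        [:w i j:] * (P (Suc i) * T j)"
      by (simp only: j') simp
    have "W * (p * (([:0, 1:] - A) * t1 - B * t2)) + A * (W * (p * t1)) + W * (B * (p * t2)) =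
        [:0, 1:] * (W * (p * t1))" for W p A t1 B t2 :: "real poly"
      by (simp only: algebra_simps)
    note alg = this
    have le: "i \<le> j" and ne: "i \<noteq> j" using less by auto
    show ?thesis
      unfolding 1 r_next[OF le ij(2)] r_le[OF le] if_not_P[OF ne] diff_zero
        rjac_step[OF ij(2)] linear_split by (rule alg)
  next
    case equal
    have W: "P (Suc n) = P (Suc j) * (([:0, 1:] - [:a j:]) * T (Suc j) - [:b (Suc j):] * T (Suc (Suc j)))
        - [:b j:] * (P j * T (Suc j))"
      using jac_wronskian[of j n a b] ij by (simp only: rjac_step linear_split less_imp_le)
    have "B * (p0 * t) + A * (p * t) + B' * (p * t') =
      [:0, 1:] * (p * t) - (p * (([:0, 1:] - A) * t - B' * t') - B * (p0 * t))"
      for A B B' p p0 t t' :: "real poly"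
      by (simp only: algebra_simps)
    note alg = this
    have w: "[:w j j:] = 1" by (simp add: w_refl)
    show ?thesis
      unfolding equal r_prev[OF order_refl ij(2)] r_next[OF order_refl ij(2)]
        r_le[OF order_refl] if_P[OF refl] W w mult_1_left by (rule alg)
  next
    case greater
    have "[:G $$ (Suc j, j):] * [:w i (Suc j):] = [:w i j:]"
      using greater by (simp add: w_down)
    moreover have "r i (Suc j) = [:w i (Suc j):] * (P (Suc (Suc j)) * T (Suc i))"
      using greater by (simp only: r_ge Suc_leI)
    ultimately have "[:G $$ (Suc j, j):] * r i (Suc j) = [:w i j:] * (P (Suc (Suc j)) * T (Suc i))"
      by (simp only: mult.assoc[symmetric])
    then have 1: "(if Suc j < n then [:G $$ (Suc j, j):] * r i (Suc j) else 0) =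
        [:w i j:] * (P (Suc (Suc j)) * T (Suc i))"
      using greater ij by (simp only: if_True order.strict_trans1[OF Suc_leI])
    have "W * (B * (p0 * t)) + A * (W * (p * t)) + W * ((([:0, 1:] - A) * p - B * p0) * t) =
        [:0, 1:] * (W * (p * t))" for W p A t p0 B :: "real poly"
      by (simp only: algebra_simps)
    note alg = this
    have le: "j \<le> i" and ne: "i \<noteq> j" using greater by auto
    show ?thesis
      unfolding 1 r_prev[OF le ij(1)] r_ge[OF le] if_not_P[OF ne] diff_zero
        jac.simps(3) linear_split by (rule alg)
  qed
  finally show ?thesis .
qed

lemma root_imp_eigenvalue:
  assumes "poly (P (Suc n)) t = 0" "0 < n"
  shows "poly (char_poly (- G)) (- t) = 0"
proof -
  let ?v = "vec n (\<lambda>l. poly (r 0 l) t)"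
  have c: "transpose_mat (- G) \<in> carrier_mat n n"
    using G_carrier by simp
  have "r 0 (n - 1) = [:w 0 (n - 1):]"
    using assms(2) by (simp add: r_le)
  then have "?v $ (n - 1) \<noteq> 0\<^sub>v n $ (n - 1)"
    using w_pos[of 0 "n - 1"] assms(2) by simp
  then have nz: "?v \<noteq> 0\<^sub>v n" by metis
  have "transpose_mat (- G) *\<^sub>v ?v = (- t) \<cdot>\<^sub>v ?v"
  proof (rule eq_vecI)
    fix j assume "j < dim_vec ((- t) \<cdot>\<^sub>v ?v)"
    then have j: "j < n" by simp
    have "(transpose_mat (- G) *\<^sub>v ?v) $ j = - (\<Sum>l<n. G $$ (l, j) * poly (r 0 l) t)"
      using j G_carrier
      by (simp add: mult_mat_vec_def scalar_prod_def sum_negf lessThan_atLeast0)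
    also have "(\<Sum>l<n. G $$ (l, j) * poly (r 0 l) t) = poly (\<Sum>l<n. [:G $$ (l, j):] * r 0 l) t"
      by (simp add: poly_sum)
    also have "\<dots> = t * poly (r 0 j) t"
      using assms j by (subst adjugate_equation) auto
    finally show "(transpose_mat (- G) *\<^sub>v ?v) $ j = ((- t) \<cdot>\<^sub>v ?v) $ j"
      using j by simp
  qed (use c in simp)
  then have "eigenvalue (transpose_mat (- G)) (- t)"
    unfolding eigenvalue_def eigenvector_def using nz c by (intro exI[of _ ?v]) auto
  then show ?thesis
    using eigenvalue_root_char_poly[OF c] G_carrier by simp
qed

lemma jac_eq_prod_eigenvalues:
  assumes "char_poly (- G) = (\<Prod>i<n. [:- \<nu> i, 1:])" "0 < n"
  shows "P (Suc n) = (\<Prod>i<n. [:- (- \<nu> i), 1:])"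
proof -
  obtain z where z: "strict_mono_on {..<n} z" "P (Suc n) = (\<Prod>l<n. [:- z l, 1:])"
    using jac_sturm[of b n a, OF b_pos] by blast
  have root: "poly (P (Suc n)) (z l) = 0" if "l < n" for l
    using that by (auto simp: z(2) poly_prod)
  have "(\<lambda>l. - z l) ` {..<n} \<subseteq> \<nu> ` {..<n}"
  proof
    fix y assume "y \<in> (\<lambda>l. - z l) ` {..<n}"
    then have "poly (char_poly (- G)) y = 0"
      using root_imp_eigenvalue root assms(2) by auto
    then show "y \<in> \<nu> ` {..<n}"
      by (auto simp: assms(1) poly_prod)
  qed
  moreover have card: "card ((\<lambda>l. - z l) ` {..<n}) = n"
    using strict_mono_on_imp_inj_on[OF z(1)] by (subst card_image) (auto simp: inj_on_def)
  ultimately have img: "(\<lambda>l. - z l) ` {..<n} = \<nu> ` {..<n}"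
    by (intro card_subset_eq) (auto intro!: antisym card_image_le[THEN order.trans] dest: card_mono[rotated])
  then have "inj_on \<nu> {..<n}"
    using card by (intro eq_card_imp_inj_on) auto
  moreover have "poly (P (Suc n)) (- \<nu> i) = 0" if "i < n" for i
  proof -
    have "\<nu> i \<in> (\<lambda>l. - z l) ` {..<n}"
      using img that by auto
    then show ?thesis using root by auto
  qed
  moreover have "degree (P (Suc n)) = card {..<n}"
    by (simp only: degree_jac card_lessThan)
  ultimately show ?thesis
    by (intro monic_eq_prod_linear[OF _ lead_coeff_jac]) (auto simp: inj_on_def)
qed

definition M :: "(nat \<Rightarrow> real) \<Rightarrow> nat \<Rightarrow> nat \<Rightarrow> nat \<Rightarrow> real" where
  "M x k i j = divdiff (\<Prod>m=k..<n. [:- x m, 1:]) (r i j)"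

lemma degree_T: "j < n \<Longrightarrow> degree (T (Suc j)) = n - Suc j"
  by (simp add: rjac_def Suc_diff_Suc[symmetric] degree_jac del: jac.simps)

lemma lead_coeff_T: "j < n \<Longrightarrow> lead_coeff (T (Suc j)) = 1"
  unfolding rjac_def by (metis Suc_diff_Suc diff_Suc_Suc lead_coeff_jac)

lemma M_0:
  assumes ij: "i < n" "j < n"
  shows "M x 0 i j = (if i = j then 1 else 0)"
proof -
  let ?f = "P (Suc (min i j)) * T (Suc (max i j))"
  have max: "max i j < n" using ij by simp
  have lc: "lead_coeff ?f = 1"
    by (simp only: lead_coeff_mult lead_coeff_jac lead_coeff_T[OF max] mult_1)
  have "T (Suc (max i j)) \<noteq> 0"
    using lead_coeff_T[OF max] by auto
  then have deg: "degree ?f = min i j + (n - Suc (max i j))"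
    by (simp add: degree_mult_eq jac_nonzero degree_jac degree_T[OF max] del: jac.simps)
  have "M x 0 i j = w i j * divdiff (\<Prod>m=0..<n. [:- x m, 1:]) ?f"
    by (simp add: M_def r_def divdiff_smult)
  also have "divdiff (\<Prod>m=0..<n. [:- x m, 1:]) ?f = coeff ?f (n - 1)"
    using deg ij by (subst divdiff_less) (auto simp: degree_prod_linear)
  also have "w i j * coeff ?f (n - 1) = (if i = j then 1 else 0)"
  proof (cases "i = j")
    case True
    then show ?thesis using lc deg ij by (simp add: w_refl)
  next
    case False
    then have "degree ?f < n - 1" using deg ij by (auto simp: min_def max_def)
    then show ?thesis using False by (simp add: coeff_eq_0)
  qed
  finally show ?thesis .
qed

lemma M_n: "M x n i j = 0"
  by (simp add: M_def divdiff_def)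

lemma M_step:
  assumes "P (Suc n) = (\<Prod>m<n. [:- x m, 1:])" and k: "k < n" and ij: "i < n" "j < n"
  shows "M x (Suc k) i j = (\<Sum>l<n. M x k i l * G $$ (l, j)) - x k * M x k i j"
proof -
  let ?Q = "\<lambda>k. \<Prod>m=k..<n. [:- x m, 1:]"
  have Q: "?Q k = [:- x k, 1:] * ?Q (Suc k)"
    using k by (rule prod.atLeast_Suc_lessThan)
  have "?Q k dvd P (Suc n)"
    unfolding assms(1) lessThan_atLeast0 by (rule prod_dvd_prod_subset) auto
  then have 0: "divdiff (?Q k) (if i = j then P (Suc n) else 0) = 0"
    by (simp add: divdiff_dvd divdiff_0)
  have "(\<Sum>l<n. M x k i l * G $$ (l, j)) = divdiff (?Q k) (\<Sum>l<n. [:G $$ (l, j):] * r i l)"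
    by (simp add: M_def divdiff_sum divdiff_smult mult.commute)
  also have "\<dots> = divdiff (?Q k) ([:0, 1:] * r i j)"
    unfolding adjugate_equation[OF ij] divdiff_diff 0 by simp
  finally have "(\<Sum>l<n. M x k i l * G $$ (l, j)) - x k * M x k i j =
      divdiff (?Q k) ([:0, 1:] * r i j - Polynomial.smult (x k) (r i j))"
    by (simp only: divdiff_diff divdiff_smult M_def)
  also have "[:0, 1:] * r i j - Polynomial.smult (x k) (r i j) = [:- x k, 1:] * r i j"
    by simp
  also have "divdiff (?Q k) ([:- x k, 1:] * r i j) = M x (Suc k) i j"
    unfolding Q M_def by (rule divdiff_cancel[OF prod_linear_nonzero])
  finally show ?thesis by simp
qed

lemma M_nonneg:
  assumes "P (Suc n) = (\<Prod>m<n. [:- x m, 1:])" "\<And>i j. i \<le> j \<Longrightarrow> j < n \<Longrightarrow> x i \<le> x j"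
    and ij: "i < n" "j < n"
  shows "0 \<le> M x k i j"
proof -
  have "0 \<le> divdiff (\<Prod>m=k..<n. [:- x m, 1:]) (P (Suc (min i j)) * T (Suc (max i j)))"
    using ij by (intro divdiff_jac_nonneg[OF b_pos b_0 _ _ assms(1,2)]) auto
  then show ?thesis
    using w_pos[OF ij] by (simp add: M_def r_def divdiff_smult)
qed

lemma left_kernel_eq_0:
  fixes z :: "nat \<Rightarrow> real"
  assumes "\<And>j. j < n \<Longrightarrow> (\<Sum>l<n. z l * G $$ (l, j)) = 0" "z 0 = 0" "i < n"
  shows "z i = 0"
  using assms(3)
proof (induction i rule: less_induct)
  case (less i)
  show ?case
  proof (cases i)
    case (Suc i')
    have "0 = (\<Sum>l<n. z l * G $$ (l, i'))"
      using assms(1)[of i'] less.prems Suc by simp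
    also have "\<dots> = z i * G $$ (i, i')"
      using less Suc by (subst sum_tridiagonal[of i']) (auto simp: tri)
    finally show ?thesis
      using down_pos[of i'] less.prems Suc by auto
  qed (use assms(2) in simp)
qed

lemma left_kernel_unique:
  fixes p q :: "nat \<Rightarrow> real"
  assumes "\<And>j. j < n \<Longrightarrow> (\<Sum>l<n. p l * G $$ (l, j)) = 0"
    and "\<And>j. j < n \<Longrightarrow> (\<Sum>l<n. q l * G $$ (l, j)) = 0"
    and "(\<Sum>l<n. p l) = 1" "(\<Sum>l<n. q l) = 1" "i < n"
  shows "p i = q i"
proof -
  have lin: "(\<Sum>l<n. (\<alpha> * p l - \<beta> * q l) * G $$ (l, j)) = 0" if "j < n" for \<alpha> \<beta> j
  proof -
    have "(\<Sum>l<n. (\<alpha> * p l - \<beta> * q l) * G $$ (l, j)) =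
        \<alpha> * (\<Sum>l<n. p l * G $$ (l, j)) - \<beta> * (\<Sum>l<n. q l * G $$ (l, j))"
      by (simp add: left_diff_distrib sum_subtractf sum_distrib_left mult.assoc)
    then show ?thesis using assms(1,2) that by simp
  qed
  have "q 0 * p l - p 0 * q l = 0" if "l < n" for l
    by (rule left_kernel_eq_0[OF lin _ that]) simp_all
  then have "(\<Sum>l<n. q 0 * p l - p 0 * q l) = 0" by simp
  then have "q 0 * (\<Sum>l<n. p l) - p 0 * (\<Sum>l<n. q l) = 0"
    by (simp add: sum_subtractf sum_distrib_left)
  then have "q 0 = p 0" using assms(3,4) by simp
  then have "1 * p i - 1 * q i = 0"
    by (intro left_kernel_eq_0[OF lin _ assms(5)]) simp_all
  then show ?thesis by simp
qed

end

lemma foldr_mult_mat: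
  fixes F :: "nat \<Rightarrow> 'a::semiring_1 mat"
  assumes "\<And>i. F i \<in> carrier_mat n n" "A \<in> carrier_mat n n"
  shows "foldr (\<lambda>i M. F i * M) is A \<in> carrier_mat n n \<and>
    foldr (\<lambda>i M. F i * M) is A = foldr (\<lambda>i M. F i * M) is (1\<^sub>m n) * A \<and>
    foldr (\<lambda>i M. F i * M) is (1\<^sub>m n) \<in> carrier_mat n n"
proof (induction "is")
  case (Cons i "is")
  let ?p = "foldr (\<lambda>i M. F i * M) is"
  have "F i * ?p A = F i * (?p (1\<^sub>m n) * A)"
    using Cons by metis
  also have "\<dots> = F i * ?p (1\<^sub>m n) * A"
    by (rule assoc_mult_mat[OF assms(1) _ assms(2), symmetric]) (use Cons in blast)
  finally have "F i * ?p A = F i * ?p (1\<^sub>m n) * A" .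
  moreover have "F i * ?p A \<in> carrier_mat n n" "F i * ?p (1\<^sub>m n) \<in> carrier_mat n n"
    using Cons by (blast intro: mult_carrier_mat[OF assms(1)])+
  ultimately show ?case by (simp only: foldr.simps o_apply simp_thms)
qed (use assms in auto)

lemma (in birth_death) foldr_eq_M:
  assumes chi: "P (Suc n) = (\<Prod>m<n. [:- (- \<nu> m), 1:])" and "k \<le> n"
  shows "foldr (\<lambda>i M. (G + \<nu> i \<cdot>\<^sub>m 1\<^sub>m n) * M) [0..<k] (1\<^sub>m n) =
    mat n n (\<lambda>(i, j). M (\<lambda>m. - \<nu> m) k i j)"
  using assms(2)
proof (induction k)
  case 0
  show ?case by (rule eq_matI) (auto simp: M_0)
next
  case (Suc k)
  let ?F = "\<lambda>i. G + \<nu> i \<cdot>\<^sub>m 1\<^sub>m n" and ?M = "M (\<lambda>m. - \<nu> m)"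
  have F: "?F i \<in> carrier_mat n n" for i
    using G_carrier by simp
  have "foldr (\<lambda>i M. ?F i * M) [0..<Suc k] (1\<^sub>m n) = foldr (\<lambda>i M. ?F i * M) [0..<k] (?F k)"
    using right_mult_one_mat[OF F] by simp
  also have "\<dots> = foldr (\<lambda>i M. ?F i * M) [0..<k] (1\<^sub>m n) * ?F k"
    using foldr_mult_mat[of ?F n "?F k", OF F F] by blast
  also have "\<dots> = mat n n (\<lambda>(i, j). ?M k i j) * ?F k"
    using Suc by simp
  also have "\<dots> = mat n n (\<lambda>(i, j). ?M (Suc k) i j)"
  proof (rule eq_matI)
    fix i j assume "i < dim_row (mat n n (\<lambda>(i, j). ?M (Suc k) i j))"
      "j < dim_col (mat n n (\<lambda>(i, j). ?M (Suc k) i j))"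
    then have ij: "i < n" "j < n" by auto
    have "(mat n n (\<lambda>(i, j). ?M k i j) * ?F k) $$ (i, j) =
        (\<Sum>l<n. ?M k i l * (G $$ (l, j) + \<nu> k * (if l = j then 1 else 0)))"
      using ij G_carrier by (simp add: scalar_prod_def lessThan_atLeast0)
    also have "\<dots> = (\<Sum>l<n. ?M k i l * G $$ (l, j) + (if l = j then \<nu> k * ?M k i j else 0))"
      by (intro sum.cong) (auto simp: algebra_simps)
    also have "\<dots> = (\<Sum>l<n. ?M k i l * G $$ (l, j)) + \<nu> k * ?M k i j"
      using ij by (simp add: sum.distrib)
    also have "\<dots> = ?M (Suc k) i j"
      using M_step[OF chi _ ij, of k] Suc.prems by simp
    finally show "(mat n n (\<lambda>(i, j). ?M k i j) * ?F k) $$ (i, j) =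
        mat n n (\<lambda>(i, j). ?M (Suc k) i j) $$ (i, j)"
      using ij by simp
  qed (use G_carrier in auto)
  finally show ?case .
qed

theorem lemma5p2:
  fixes d :: nat and G :: "real mat" and \<pi> :: "real vec" and \<nu> :: "nat \<Rightarrow> real"
  assumes "ergodic_birth_death_generator d G"
    and "stationary_pmf (d + 1) G \<pi>"
    and "ordered_eigenvalues d (- G) \<nu>"
    and "\<nu> d = 0"
    and "d \<ge> 1 \<longrightarrow> \<nu> (d - 1) > 0"
  shows "(\<forall>k\<le>d. stochastic_mat (d + 1) (Q_mat d G \<nu> k)) \<and>
         (\<forall>i\<le>d. row (Q_mat d G \<nu> d) i = \<pi>)"
proof -
  define n where "n = d + 1"
  have gen: "generator n G" and "tridiagonal n G" "irreducible_chain n G"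
    using assms(1) by (simp_all add: ergodic_birth_death_generator_def n_def)
  then interpret birth_death n G
    by unfold_locales (auto simp: irreducible_tridiagonal_pos generator_def tridiagonal_def)
  let ?M = "M (\<lambda>m. - \<nu> m)"
  have mono: "\<nu> j \<le> \<nu> i" if "i \<le> j" "j < n" for i j
    using assms(3) that by (simp add: ordered_eigenvalues_def n_def)
  have "char_poly (- G) = (\<Prod>i<n. [:- \<nu> i, 1:])"
    using assms(3) by (simp add: ordered_eigenvalues_def n_def lessThan_Suc_atMost)
  then have chi: "P (Suc n) = (\<Prod>i<n. [:- (- \<nu> i), 1:])"
    by (rule jac_eq_prod_eigenvalues) (simp add: n_def)
  have pos: "0 < \<nu> i" if "i < d" for i
  proof -
    have "i \<le> d - 1" "d - 1 < n" "1 \<le> d" using that by (auto simp: n_def)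
    then show ?thesis using mono assms(5) by fastforce
  qed
  define c where "c = (\<lambda>k. \<Prod>i<k. inverse (\<nu> i))"
  have c_pos: "0 < c k" if "k \<le> d" for k
    unfolding c_def using pos that by (intro prod_pos) auto
  have Q: "Q_mat d G \<nu> k = mat n n (\<lambda>(i, j). c k * ?M k i j)" if "k \<le> n" for k
  proof -
    have "Q_mat d G \<nu> k = c k \<cdot>\<^sub>m mat n n (\<lambda>(i, j). ?M k i j)"
      unfolding Q_mat_def c_def n_def[symmetric] foldr_eq_M[OF chi that] ..
    also have "\<dots> = mat n n (\<lambda>(i, j). c k * ?M k i j)"
      by (rule eq_matI) auto
    finally show ?thesis .
  qed
  have row_sum: "(\<Sum>j<n. c k * ?M k i j) = 1" if "k \<le> d" "i < n" for k i
    using that(1)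
  proof (induction k)
    case 0
    show ?case using that(2) by (simp add: c_def M_0)
  next
    case (Suc k)
    have k: "k < n" using Suc.prems by (simp add: n_def)
    have "(\<Sum>j<n. ?M (Suc k) i j) =
        (\<Sum>j<n. \<Sum>l<n. ?M k i l * G $$ (l, j)) + \<nu> k * (\<Sum>j<n. ?M k i j)"
      using M_step[OF chi k that(2)]
      by (simp add: sum.distrib sum_distrib_left)
    also have "(\<Sum>j<n. \<Sum>l<n. ?M k i l * G $$ (l, j)) = (\<Sum>l<n. ?M k i l * (\<Sum>j<n. G $$ (l, j)))"
      by (subst sum.swap) (simp add: sum_distrib_left)
    also have "\<dots> = 0"
      using gen by (simp add: generator_def)
    finally have "(\<Sum>j<n. c (Suc k) * ?M (Suc k) i j) = c (Suc k) * (\<nu> k * (\<Sum>j<n. ?M k i j))"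
      by (simp flip: sum_distrib_left)
    also have "\<dots> = (\<Sum>j<n. c k * ?M k i j)"
      using pos[of k] Suc.prems by (simp add: c_def flip: sum_distrib_left)
    finally show ?case using Suc by simp
  qed
  have "stochastic_mat (d + 1) (Q_mat d G \<nu> k)" if "k \<le> d" for k
  proof -
    have "0 \<le> ?M k i j" if "i < n" "j < n" for i j
      by (rule M_nonneg[OF chi _ that]) (use mono in auto)
    moreover have "k \<le> n" using that by (simp add: n_def)
    ultimately show ?thesis
      using row_sum[OF that] c_pos[OF that]
      unfolding stochastic_mat_def n_def[symmetric] by (auto simp: Q)
  qed
  moreover have "row (Q_mat d G \<nu> d) i = \<pi>" if "i \<le> d" for i
  proof (rule eq_vecI)
    have pi: "\<pi> \<in> carrier_vec n" "(\<Sum>l<n. \<pi> $ l) = 1" "transpose_mat G *\<^sub>v \<pi> = 0\<^sub>v n"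
      using assms(2) by (auto simp: stationary_pmf_def prob_mass_vec_def n_def)
    have i: "i < n" using that by (simp add: n_def)
    fix j assume "j < dim_vec \<pi>"
    then have j: "j < n" using pi(1) by simp
    have "c d * ?M d i j = \<pi> $ j"
    proof (rule left_kernel_unique[OF _ _ _ pi(2) j])
      fix j assume j: "j < n"
      have "(\<Sum>l<n. ?M d i l * G $$ (l, j)) = 0"
        using M_step[OF chi _ i j, of d] assms(4) M_n by (simp add: n_def)
      then show "(\<Sum>l<n. c d * ?M d i l * G $$ (l, j)) = 0"
        by (simp add: mult.assoc flip: sum_distrib_left)
      have "(\<Sum>l<n. G $$ (l, j) * \<pi> $ l) = (transpose_mat G *\<^sub>v \<pi>) $ j"
        using j pi(1) G_carrier by (simp add: scalar_prod_def lessThan_atLeast0)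
      then show "(\<Sum>l<n. \<pi> $ l * G $$ (l, j)) = 0"
        using pi(3) j by (simp add: mult.commute)
    qed (rule row_sum[OF order_refl i])
    then show "row (Q_mat d G \<nu> d) i $ j = \<pi> $ j"
      using i j by (simp add: Q n_def)
  next
    have "\<pi> \<in> carrier_vec n"
      using assms(2) by (auto simp: stationary_pmf_def prob_mass_vec_def n_def)
    then show "dim_vec (row (Q_mat d G \<nu> d) i) = dim_vec \<pi>"
      by (simp add: Q n_def)
  qed
  ultimately show ?thesis by blast
qed

end
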